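(* Let $X$ be a Banach space and let $T$ be a bounded linear operator on $X$. If $T$ is Li-Yorke chaotic, then there exist $x\in X$ and subsets $A,B\subset\mathbb N$ with $\overline{\mathrm{Bd}}(A)=\overline{\mathrm{Bd}}(B)=1$ such that $T^nx\to0$ as $n\to\infty$ with $n\in A$, and $\|T^nx\|\to\infty$ as $n\to\infty$ with $n\in B$.
   Context: $T$ is Li-Yorke chaotic if there is an uncountable set $\Gamma\subset X$ such that for every pair $(x,y)\in\Gamma\times\Gamma$ of distinct points, $\liminf_{n\to\infty}\|T^nx-T^ny\|=0$ and $\limsup_{n\to\infty}\|T^nx-T^ny\|>0$. For $A\subset\mathbb N$, the Banach upper density is $\overline{\mathrm{Bd}}(A)=\lim_{n\to\infty}\limsup_{m\to\infty}\frac{\mathrm{card}(A\cap[m+1,m+n])}{n}$. *)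

theory Defs
  imports "HOL-Analysis.Analysis"
begin

(* Values are taken in ereal because the limsup of an unbounded orbit may be infinite. *)
definition li_yorke_chaotic :: "('a::real_normed_vector \<Rightarrow> 'a) \<Rightarrow> bool" where
  "li_yorke_chaotic T \<longleftrightarrow>
     (\<exists>\<Gamma>. uncountable \<Gamma> \<and>
        (\<forall>x\<in>\<Gamma>. \<forall>y\<in>\<Gamma>. x \<noteq> y \<longrightarrow>
           liminf (\<lambda>n. ereal (norm ((T ^^ n) x - (T ^^ n) y))) = 0 \<and>
           limsup (\<lambda>n. ereal (norm ((T ^^ n) x - (T ^^ n) y))) > 0))"

(* The outer limit exists for every A, since the inner limsup, multiplied by n,
   is subadditive in n. *)
definition banach_upper_density :: "nat set \<Rightarrow> ereal" where
  "banach_upper_density A =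
     lim (\<lambda>n. limsup (\<lambda>m. ereal (real (card (A \<inter> {m+1..m+n})) / real n)))"

end

theory Submission
  imports Defs
begin

(* Irregular vectors (orbits with lower limit 0 and upper limit infinity) already suffice. The
   difference u of a Li-Yorke pair has an orbit that tends to 0 along a subsequence but not as a
   whole, so T is not power bounded on the closed span Y of the orbit of u, while a dense set of
   vectors of Y has small iterates along that same subsequence; Baire's theorem in Y then yields an
   irregular vector x. If norm T \<le> C, then a tiny norm (T^m x) keeps the next iterates small, and
   a huge norm (T^m x) forces the preceding iterates to be large; hence the times at which
   the orbit is small, or large, contain arbitrarily long intervals. *)

section \<open>Sets of Banach upper density 1\<close>

text \<open>For each \<open>n\<close> at least 1 the inner limsup is already 1: the quotient never
  exceeds 1 and equals 1 for arbitrarily large \<open>m\<close>. So the outer sequence is eventually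
  constant; only \<open>n = 0\<close>, where the quotient is 0/0 = 0, differs.\<close>

lemma banach_upper_density_eq_1:
  assumes "\<And>n N. \<exists>m\<ge>N. {m+1..m+n} \<subseteq> A"
  shows "banach_upper_density A = 1"
proof -
  have "limsup (\<lambda>m. ereal (real (card (A \<inter> {m+1..m+n})) / real n)) = 1" (is "limsup ?f = 1")
    if n: "n \<ge> 1" for n
  proof (rule antisym)
    have "card (A \<inter> {m+1..m+n}) \<le> n" for m
      using card_mono[of "{m+1..m+n}" "A \<inter> {m+1..m+n}"] by simp
    then show "limsup ?f \<le> 1"
      using n by (intro Limsup_bounded always_eventually) (auto simp: divide_simps)
    show "1 \<le> limsup ?f"
    proof (rule ccontr)
      assume "\<not> 1 \<le> limsup ?f"
      then have "eventually (\<lambda>m. ?f m < 1) sequentially"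
        by (intro Limsup_lessD) simp
      then obtain N where N: "\<And>m. m \<ge> N \<Longrightarrow> ?f m < 1"
        by (auto simp: eventually_sequentially)
      obtain m where "m \<ge> N" and "{m+1..m+n} \<subseteq> A"
        using assms by blast
      then have "A \<inter> {m+1..m+n} = {m+1..m+n}" by blast
      then have "?f m = 1" using n by simp
      with N[OF \<open>m \<ge> N\<close>] show False by simp
    qed
  qed
  then have "(\<lambda>n. limsup (\<lambda>m. ereal (real (card (A \<inter> {m+1..m+n})) / real n))) \<longlonglongrightarrow> 1"
    by (intro tendsto_eventually eventually_sequentiallyI)
  then show ?thesis
    unfolding banach_upper_density_def by (rule limI)
qed

text \<open>Let \<open>A\<close> be the union over \<open>k\<close> of one block of length
  \<open>k\<close> on which \<open>P k\<close> holds. By \<open>anti\<close>, only the blocks with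
  index below \<open>k\<close> can violate \<open>P k\<close>, and these are finitely many finite
  sets.\<close>

lemma diagonal_set_of_density_1:
  fixes P :: "nat \<Rightarrow> nat \<Rightarrow> bool"
  assumes blocks: "\<And>k N. \<exists>m\<ge>N. \<forall>i\<in>{m+1..m+k}. P k i"
    and anti: "\<And>k l i. k \<le> l \<Longrightarrow> P l i \<Longrightarrow> P k i"
  obtains A where "banach_upper_density A = 1"
    and "\<And>k. eventually (P k) (inf sequentially (principal A))"
proof -
  have "\<forall>k. \<exists>m. m \<ge> k \<and> (\<forall>i\<in>{m+1..m+k}. P k i)"
    using blocks by blast
  then obtain m where "\<forall>k. m k \<ge> k \<and> (\<forall>i\<in>{m k+1..m k+k}. P k i)"
    by (rule choice[THEN exE])
  then have m: "\<And>k. m k \<ge> k" "\<And>k i. i \<in> {m k+1..m k+k} \<Longrightarrow> P k i"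
    by blast+
  define A where "A = (\<Union>k. {m k+1..m k+k})"
  have "banach_upper_density A = 1"
  proof (rule banach_upper_density_eq_1)
    fix n N
    \<comment> \<open>The index \<open>max n N\<close> makes the block both long enough and far
      enough out.\<close>
    have "m (max n N) \<ge> N"
      using m(1)[of "max n N"] by simp
    moreover have "{m (max n N) + 1..m (max n N) + n} \<subseteq> {m (max n N) + 1..m (max n N) + max n N}"
      by auto
    ultimately show "\<exists>m'\<ge>N. {m'+1..m'+n} \<subseteq> A"
      unfolding A_def by blast
  qed
  moreover have "eventually (P k) (inf sequentially (principal A))" for k
    unfolding eventually_inf_principal eventually_sequentially
  proof (intro exI allI impI)
    \<comment> \<open>The sum bounds the right ends \<open>m j + j\<close> of all blocks with index
      below \<open>k\<close>.\<close>
    fix n assume n: "(\<Sum>j<k. m j + j) + 1 \<le> n" and "n \<in> A"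
    then obtain l where l: "n \<in> {m l+1..m l+l}"
      unfolding A_def by blast
    have "k \<le> l"
    proof (rule ccontr)
      assume "\<not> k \<le> l"
      then have "m l + l \<le> (\<Sum>j<k. m j + j)"
        by (intro member_le_sum) auto
      with l n show False by simp
    qed
    with m(2)[OF l] show "P k n" by (rule anti[rotated])
  qed
  ultimately show thesis by (rule that)
qed

section \<open>Iterates of a bounded operator\<close>

lemma bounded_linear_funpow:
  assumes "bounded_linear (T :: 'a::real_normed_vector \<Rightarrow> 'a)"
  shows "bounded_linear (T ^^ n)"
proof (induction n)
  case 0
  then show ?case by (simp add: id_def)
next
  case (Suc n)
  then show ?case
    using bounded_linear_compose[OF assms Suc] by (simp add: o_def)
qed

lemma norm_funpow_add_le:
  fixes T :: "'a::real_normed_vector \<Rightarrow> 'a"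
  assumes "\<And>x. norm (T x) \<le> C * norm x" and "C \<ge> 0"
  shows "norm ((T ^^ (n + i)) x) \<le> C ^ i * norm ((T ^^ n) x)"
proof (induction i)
  case (Suc i)
  have "norm ((T ^^ (n + Suc i)) x) \<le> C * norm ((T ^^ (n + i)) x)"
    using assms(1) by simp
  also have "\<dots> \<le> C * (C ^ i * norm ((T ^^ n) x))"
    using Suc assms(2) by (rule mult_left_mono)
  finally show ?case by (simp add: mult.assoc)
qed simp

section \<open>Irregular vectors by Baire category\<close>

text \<open>If some \<open>U j\<close> were not dense in the closed span of the orbit, the iterates
  from time \<open>j\<close> on would be uniformly bounded on the span, and then the null
  subsequence would force the whole orbit of \<open>u\<close> to tend to 0.\<close>

lemma irregular_vector_exists:
  fixes T :: "'a::banach \<Rightarrow> 'a"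
  assumes T: "bounded_linear T" and r: "strict_mono r"
    and null: "(\<lambda>k. (T ^^ r k) u) \<longlonglongrightarrow> 0"
    and not_null: "\<not> (\<lambda>n. (T ^^ n) u) \<longlonglongrightarrow> 0"
  obtains x where "\<And>N e. e > 0 \<Longrightarrow> \<exists>n\<ge>N. norm ((T ^^ n) x) < e"
    and "\<And>N K. \<exists>n\<ge>N. norm ((T ^^ n) x) > K"
proof -
  note Tn = bounded_linear_funpow[OF T]
  define W where "W = span (range (\<lambda>n. (T ^^ n) u))"
  have W: "subspace W" unfolding W_def by (rule subspace_span)
  have orbit: "(T ^^ n) u \<in> W" for n
    unfolding W_def by (rule span_base) simp
  let ?X = "top_of_set (closure W)"
  \<comment> \<open>One index \<open>j\<close> controls both time and size, so a point of every
    \<open>U j\<close> and every \<open>V j\<close> is irregular, and countably many open sets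
    suffice.\<close>
  define U where "U j = {y. \<exists>n\<ge>j. norm ((T ^^ n) y) > real j}" for j :: nat
  define V where "V j = {y. \<exists>n\<ge>j. norm ((T ^^ n) y) < 1 / real (Suc j)}" for j :: nat
  have cont: "continuous_on UNIV (\<lambda>y. norm ((T ^^ n) y))" for n
    by (intro continuous_on_norm linear_continuous_on Tn)
  have openU: "open (U j)" for j
  proof -
    have "U j = (\<Union>n\<in>{j..}. {y. real j < norm ((T ^^ n) y)})"
      by (auto simp: U_def)
    then show ?thesis
      using cont by (auto intro!: open_Collect_less continuous_on_const)
  qed
  have openV: "open (V j)" for j
  proof -
    have "V j = (\<Union>n\<in>{j..}. {y. norm ((T ^^ n) y) < 1 / real (Suc j)})"
      by (auto simp: V_def)
    then show ?thesis
      using cont by (auto intro!: open_Collect_less continuous_on_const simp del: of_nat_Suc)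
  qed
  have denseV: "W \<subseteq> V j" for j
  proof -
    \<comment> \<open>The vectors that are null along \<open>r\<close> form a subspace; it contains
      the orbit of \<open>u\<close> because powers of \<open>T\<close> commute, hence it contains
      \<open>W\<close>.\<close>
    have "subspace {y. (\<lambda>k. (T ^^ r k) y) \<longlonglongrightarrow> 0}"
    proof (rule subspaceI)
      show "0 \<in> {y. (\<lambda>k. (T ^^ r k) y) \<longlonglongrightarrow> 0}"
        using linear_0[OF bounded_linear.linear[OF Tn]] by simp
    next
      fix x y
      assume "x \<in> {y. (\<lambda>k. (T ^^ r k) y) \<longlonglongrightarrow> 0}" "y \<in> {y. (\<lambda>k. (T ^^ r k) y) \<longlonglongrightarrow> 0}"
      then show "x + y \<in> {y. (\<lambda>k. (T ^^ r k) y) \<longlonglongrightarrow> 0}"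
        using tendsto_add[of "\<lambda>k. (T ^^ r k) x" 0 sequentially "\<lambda>k. (T ^^ r k) y" 0]
        by (simp add: linear_add[OF bounded_linear.linear[OF Tn]])
    next
      fix c x
      assume "x \<in> {y. (\<lambda>k. (T ^^ r k) y) \<longlonglongrightarrow> 0}"
      then show "c *\<^sub>R x \<in> {y. (\<lambda>k. (T ^^ r k) y) \<longlonglongrightarrow> 0}"
        using tendsto_scaleR[OF tendsto_const[of c], of "\<lambda>k. (T ^^ r k) x" 0 sequentially]
        by (simp add: linear_scale[OF bounded_linear.linear[OF Tn]])
    qed
    moreover have "(\<lambda>k. (T ^^ r k) ((T ^^ n) u)) \<longlonglongrightarrow> 0" for n
    proof -
      have "(\<lambda>k. (T ^^ n) ((T ^^ r k) u)) \<longlonglongrightarrow> (T ^^ n) 0"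
        by (rule bounded_linear.tendsto[OF Tn null])
      then have "(\<lambda>k. (T ^^ n) ((T ^^ r k) u)) \<longlonglongrightarrow> 0"
        by (simp add: linear_0[OF bounded_linear.linear[OF Tn]])
      moreover have "(T ^^ n) ((T ^^ r k) u) = (T ^^ r k) ((T ^^ n) u)" for k
        by (metis add.commute comp_apply funpow_add)
      ultimately show ?thesis by simp
    qed
    ultimately have *: "W \<subseteq> {y. (\<lambda>k. (T ^^ r k) y) \<longlonglongrightarrow> 0}"
      unfolding W_def by (intro span_minimal) auto
    show ?thesis
    proof
      fix y assume "y \<in> W"
      with * have "(\<lambda>k. norm ((T ^^ r k) y)) \<longlonglongrightarrow> 0"
        by (auto intro: tendsto_norm_zero)
      then have "eventually (\<lambda>k. norm ((T ^^ r k) y) < 1 / real (Suc j)) sequentially"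
        by (rule order_tendstoD) simp
      then obtain N where "\<And>k. k \<ge> N \<Longrightarrow> norm ((T ^^ r k) y) < 1 / real (Suc j)"
        by (auto simp: eventually_sequentially)
      then have "norm ((T ^^ r (max N j)) y) < 1 / real (Suc j)" by simp
      moreover have "r (max N j) \<ge> j"
        using seq_suble[OF r, of "max N j"] by simp
      ultimately show "y \<in> V j" unfolding V_def by blast
    qed
  qed
  have denseU: "W \<subseteq> closure (closure W \<inter> U j)" for j
  proof
    fix y assume y: "y \<in> W"
    show "y \<in> closure (closure W \<inter> U j)"
      unfolding closure_approachable
    proof (intro allI impI, rule ccontr)
      fix e :: real assume e: "e > 0" and "\<not> (\<exists>z\<in>closure W \<inter> U j. dist z y < e)"
      \<comment> \<open>A ball around \<open>y\<close> that misses \<open>U j\<close> has all its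
        iterates from time \<open>j\<close> on bounded by \<open>j\<close>.\<close>
      then have bd: "norm ((T ^^ n) z) \<le> real j" if "z \<in> W" "norm (z - y) < e" "n \<ge> j" for z n
        using that closure_subset[of W] by (force simp: U_def dist_norm)
      \<comment> \<open>Differences move this bound to a ball around 0, at the cost of a factor
        2.\<close>
      have small: "norm ((T ^^ n) w) \<le> 2 * real j" if "w \<in> W" "norm w < e" "n \<ge> j" for w n
      proof -
        have "(T ^^ n) w = (T ^^ n) (y + w) - (T ^^ n) y"
          by (simp add: linear_add[OF bounded_linear.linear[OF Tn]])
        also have "norm \<dots> \<le> norm ((T ^^ n) (y + w)) + norm ((T ^^ n) y)"
          by (rule norm_triangle_ineq4)
        also have "\<dots> \<le> real j + real j"
          using that y e W by (intro add_mono bd) (auto intro: subspace_add)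
        finally show ?thesis by simp
      qed
      \<comment> \<open>Rescaling \<open>w\<close> to norm \<open>e / 2\<close> turns the bound
        \<open>2 * real j\<close> into this constant.\<close>
      define M where "M = 4 * real j / e"
      have power_bounded: "norm ((T ^^ n) w) \<le> M * norm w" if "w \<in> W" "n \<ge> j" for w n
      proof (cases "w = 0")
        case True
        then show ?thesis by (simp add: linear_0[OF bounded_linear.linear[OF Tn]])
      next
        case False
        let ?c = "e / (2 * norm w)"
        have "norm ((T ^^ n) (?c *\<^sub>R w)) \<le> 2 * real j"
          using that e False W by (intro small) (auto intro: subspace_scale)
        then have "?c * norm ((T ^^ n) w) \<le> 2 * real j"
          using e by (simp add: linear_scale[OF bounded_linear.linear[OF Tn]])
        then show ?thesis
          using e False by (simp add: M_def field_simps)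
      qed
      have "M \<ge> 0" using e by (simp add: M_def)
      have "(\<lambda>n. (T ^^ n) u) \<longlonglongrightarrow> 0"
      proof (rule LIMSEQ_I)
        fix d :: real assume "d > 0"
        \<comment> \<open>One small iterate at time \<open>r k\<close> controls all iterates from
          time \<open>r k + j\<close> on. Dividing by \<open>M + 1\<close> covers the case
          \<open>M = 0\<close>.\<close>
        then obtain k where k: "norm ((T ^^ r k) u) < d / (M + 1)"
          using LIMSEQ_D[OF null, of "d / (M + 1)"] \<open>M \<ge> 0\<close> by auto
        show "\<exists>N. \<forall>n\<ge>N. norm ((T ^^ n) u - 0) < d"
        proof (intro exI allI impI)
          fix n assume n: "r k + j \<le> n"
          have "(T ^^ n) u = (T ^^ (n - r k)) ((T ^^ r k) u)"
            using n funpow_add[of "n - r k" "r k" T] by simp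
          then have "norm ((T ^^ n) u) \<le> M * norm ((T ^^ r k) u)"
            using n orbit power_bounded[of "(T ^^ r k) u" "n - r k"] by simp
          also have "\<dots> \<le> (M + 1) * norm ((T ^^ r k) u)"
            by (intro mult_right_mono) auto
          also have "\<dots> < d"
            using k \<open>M \<ge> 0\<close> by (simp add: field_simps)
          finally show "norm ((T ^^ n) u - 0) < d" by simp
        qed
      qed
      with not_null show False ..
    qed
  qed
  define \<G> where "\<G> = range (\<lambda>j. closure W \<inter> U j) \<union> range (\<lambda>j. closure W \<inter> V j)"
  have "?X closure_of \<Inter>\<G> = topspace ?X"
  proof (rule Baire_category)
    show "completely_metrizable_space ?X \<or> locally_compact_space ?X \<and> regular_space ?X"
      by (intro disjI1 completely_metrizable_space_closedin completely_metrizable_space_euclidean)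
        simp
    show "countable \<G>" by (simp add: \<G>_def)
  next
    fix S assume "S \<in> \<G>"
    moreover have "W \<subseteq> closure (closure W \<inter> V j)" for j
      using denseV closure_subset[of W] closure_subset[of "closure W \<inter> V j"] by blast
    ultimately obtain G where S: "S = closure W \<inter> G" "open G" "W \<subseteq> closure (closure W \<inter> G)"
      using openU openV denseU unfolding \<G>_def by blast
    \<comment> \<open>Density was shown only at points of \<open>W\<close>; it passes to the
      closure.\<close>
    have "closure W \<subseteq> closure S"
      using S by (simp add: closure_minimal)
    moreover have "?X closure_of S = closure W \<inter> closure S"
      using S(1) by (simp add: closure_of_subtopology Int_absorb1)
    ultimately show "openin ?X S \<and> ?X closure_of S = topspace ?X"
      using S(1,2) by auto
  qed
  moreover have "closure W \<noteq> {}"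
    using orbit by (metis closure_eq_empty empty_iff)
  ultimately have "\<Inter>\<G> \<noteq> {}"
    by (metis closure_of_empty topspace_euclidean_subtopology)
  then obtain x where "x \<in> \<Inter>\<G>" by blast
  then have x: "x \<in> U j" "x \<in> V j" for j
    by (auto simp: \<G>_def)
  show thesis
  proof (rule that)
    fix N :: nat and e :: real assume "e > 0"
    then obtain j where j: "1 / real (Suc j) < e"
      using nat_approx_posE by metis
    obtain n where "n \<ge> max j N" "norm ((T ^^ n) x) < 1 / real (Suc (max j N))"
      using x(2)[of "max j N"] by (auto simp: V_def)
    moreover have "1 / real (Suc (max j N)) \<le> 1 / real (Suc j)"
      by (intro divide_left_mono) auto
    ultimately show "\<exists>n\<ge>N. norm ((T ^^ n) x) < e"
      using j by (intro exI[of _ n]) auto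
  next
    fix N :: nat and K :: real
    obtain j where j: "K \<le> real j" using real_arch_simple by blast
    obtain n where "n \<ge> max j N" "norm ((T ^^ n) x) > real (max j N)"
      using x(1)[of "max j N"] by (auto simp: U_def)
    with j show "\<exists>n\<ge>N. norm ((T ^^ n) x) > K"
      by (intro exI[of _ n]) auto
  qed
qed

section \<open>From a Li-Yorke pair to the sets \<open>A\<close> and \<open>B\<close>\<close>

theorem proposition1p1:
  fixes T :: "'a::banach \<Rightarrow> 'a"
  assumes "bounded_linear T"
    and "li_yorke_chaotic T"
  shows "\<exists>(x::'a) (A::nat set) (B::nat set).
           banach_upper_density A = 1 \<and> banach_upper_density B = 1 \<and>
           ((\<lambda>n. (T ^^ n) x) \<longlongrightarrow> 0) (inf sequentially (principal A)) \<and>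
           filterlim (\<lambda>n. norm ((T ^^ n) x)) at_top (inf sequentially (principal B))"
proof -
  obtain \<Gamma> where "uncountable \<Gamma>" and \<Gamma>: "\<And>x y. x \<in> \<Gamma> \<Longrightarrow> y \<in> \<Gamma> \<Longrightarrow> x \<noteq> y \<Longrightarrow>
      liminf (\<lambda>n. ereal (norm ((T ^^ n) x - (T ^^ n) y))) = 0 \<and>
      limsup (\<lambda>n. ereal (norm ((T ^^ n) x - (T ^^ n) y))) > 0"
    using assms(2) unfolding li_yorke_chaotic_def by blast
  then have "infinite \<Gamma>" using countable_finite by blast
  then obtain a where a: "a \<in> \<Gamma>" using infinite_imp_nonempty by blast
  have "infinite (\<Gamma> - {a})" using \<open>infinite \<Gamma>\<close> by simp
  then obtain b where b: "b \<in> \<Gamma>" "a \<noteq> b" using infinite_imp_nonempty by blast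
  define f where "f = (\<lambda>n. ereal (norm ((T ^^ n) (a - b))))"
  have "f = (\<lambda>n. ereal (norm ((T ^^ n) a - (T ^^ n) b)))"
    by (simp add: f_def linear_diff[OF bounded_linear.linear[OF bounded_linear_funpow[OF assms(1)]]])
  with \<Gamma>[OF a b] have f: "liminf f = 0" "limsup f > 0" by auto
  obtain r where r: "strict_mono r" "(f \<circ> r) \<longlonglongrightarrow> liminf f"
    using liminf_subseq_lim by blast
  then have "(\<lambda>k. ereal (norm ((T ^^ r k) (a - b)))) \<longlonglongrightarrow> ereal 0"
    using f(1) by (simp add: f_def o_def zero_ereal_def)
  then have null: "(\<lambda>k. (T ^^ r k) (a - b)) \<longlonglongrightarrow> 0"
    by (simp add: tendsto_norm_zero_iff)
  have not_null: "\<not> (\<lambda>n. (T ^^ n) (a - b)) \<longlonglongrightarrow> 0"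
  proof
    assume "(\<lambda>n. (T ^^ n) (a - b)) \<longlonglongrightarrow> 0"
    then have "f \<longlonglongrightarrow> ereal 0"
      by (simp add: f_def tendsto_norm_zero_iff)
    then have "limsup f = 0"
      by (simp add: lim_imp_Limsup zero_ereal_def)
    with f(2) show False by simp
  qed
  obtain x where small: "\<And>N e. e > 0 \<Longrightarrow> \<exists>n\<ge>N. norm ((T ^^ n) x) < e"
    and large: "\<And>N K. \<exists>n\<ge>N. norm ((T ^^ n) x) > K"
    using irregular_vector_exists[OF assms(1) r(1) null not_null] by blast
  obtain K where K: "\<And>y. norm (T y) \<le> norm y * K"
    using bounded_linear.bounded[OF assms(1)] by blast
  \<comment> \<open>With \<open>C\<close> at least 1, \<open>C ^ k\<close> bounds the growth over
    any number of steps up to \<open>k\<close>.\<close>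
  define C where "C = max 1 K"
  have C: "C \<ge> 1" by (simp add: C_def)
  have TC: "norm (T y) \<le> C * norm y" for y
    using K[of y] mult_left_mono[of K C "norm y"] by (simp add: C_def mult.commute)
  have step: "norm ((T ^^ (n + i)) x) \<le> C ^ k * norm ((T ^^ n) x)" if "i \<le> k" for n i k
  proof -
    have "norm ((T ^^ (n + i)) x) \<le> C ^ i * norm ((T ^^ n) x)"
      using TC C by (intro norm_funpow_add_le) auto
    also have "\<dots> \<le> C ^ k * norm ((T ^^ n) x)"
      using C that by (intro mult_right_mono power_increasing) auto
    finally show ?thesis .
  qed
  obtain A where A: "banach_upper_density A = 1"
    and A_small: "\<And>k. eventually (\<lambda>n. norm ((T ^^ n) x) < 1 / real (Suc k)) (inf sequentially (principal A))"
  proof (rule diagonal_set_of_density_1)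
    fix k N
    \<comment> \<open>The factor \<open>C ^ k\<close> is divided out in advance, so that the next
      \<open>k\<close> iterates stay below the threshold.\<close>
    obtain m where "m \<ge> N" and m: "norm ((T ^^ m) x) < 1 / real (Suc k) / C ^ k"
      using small[of "1 / real (Suc k) / C ^ k"] C by auto
    have "norm ((T ^^ i) x) < 1 / real (Suc k)" if "i \<in> {m+1..m+k}" for i
    proof -
      have "norm ((T ^^ i) x) \<le> C ^ k * norm ((T ^^ m) x)"
        using step[of "i - m" k m] that by auto
      also have "\<dots> < 1 / real (Suc k)"
        using m C by (simp add: pos_less_divide_eq mult_ac del: of_nat_Suc)
      finally show ?thesis .
    qed
    with \<open>m \<ge> N\<close> show "\<exists>m\<ge>N. \<forall>i\<in>{m+1..m+k}. norm ((T ^^ i) x) < 1 / real (Suc k)"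
      by blast
  next
    fix k l i :: nat
    assume "k \<le> l" "norm ((T ^^ i) x) < 1 / real (Suc l)"
    moreover from this have "1 / real (Suc l) \<le> 1 / real (Suc k)"
      by (intro divide_left_mono) auto
    ultimately show "norm ((T ^^ i) x) < 1 / real (Suc k)" by linarith
  qed blast
  obtain B where B: "banach_upper_density B = 1"
    and B_large: "\<And>k. eventually (\<lambda>n. norm ((T ^^ n) x) > real k) (inf sequentially (principal B))"
  proof (rule diagonal_set_of_density_1)
    fix k N
    \<comment> \<open>The block ends at \<open>p\<close>: an iterate of norm at most
      \<open>k\<close> less than \<open>k\<close> steps earlier could not grow beyond
      \<open>C ^ k * real k\<close>. Taking \<open>p\<close> at least \<open>N + k\<close> keeps the
      natural subtraction \<open>p - k\<close> exact and at least \<open>N\<close>.\<close>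
    obtain p where p: "p \<ge> N + k" "norm ((T ^^ p) x) > C ^ k * real k"
      using large by blast
    have "norm ((T ^^ i) x) > real k" if "i \<in> {(p - k)+1..(p - k)+k}" for i
    proof -
      have "i + (p - i) = p" "p - i \<le> k" using p(1) that by auto
      then have "norm ((T ^^ p) x) \<le> C ^ k * norm ((T ^^ i) x)"
        using step[of "p - i" k i] by simp
      with p(2) have "C ^ k * real k < C ^ k * norm ((T ^^ i) x)" by linarith
      then show ?thesis using C by simp
    qed
    with p(1) show "\<exists>m\<ge>N. \<forall>i\<in>{m+1..m+k}. norm ((T ^^ i) x) > real k"
      by (intro exI[of _ "p - k"]) auto
  next
    fix k l i :: nat
    assume "k \<le> l" "norm ((T ^^ i) x) > real l"
    then show "norm ((T ^^ i) x) > real k" by simp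
  qed blast
  have "((\<lambda>n. (T ^^ n) x) \<longlongrightarrow> 0) (inf sequentially (principal A))"
    unfolding tendsto_iff
  proof (intro allI impI)
    fix e :: real assume "e > 0"
    then obtain k where "1 / real (Suc k) < e" using nat_approx_posE by metis
    with A_small[of k] show "eventually (\<lambda>n. dist ((T ^^ n) x) 0 < e) (inf sequentially (principal A))"
      by (auto elim: eventually_mono)
  qed
  moreover have "filterlim (\<lambda>n. norm ((T ^^ n) x)) at_top (inf sequentially (principal B))"
    unfolding filterlim_at_top
  proof
    fix Z :: real
    obtain k where "Z \<le> real k" using real_arch_simple by blast
    with B_large[of k] show "eventually (\<lambda>n. Z \<le> norm ((T ^^ n) x)) (inf sequentially (principal B))"
      by (auto elim: eventually_mono)
  qed
  ultimately show ?thesis using A B by blast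
qed

end
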